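(* The map $f:\Delta^3_{\alpha_1\alpha_2\ldots\alpha_n\ldots}\mapsto\Delta^3_{\theta(\alpha_1)\theta(\alpha_2)\ldots\theta(\alpha_n)\ldots}$, where $\theta(0)=0$, $\theta(1)=2$, $\theta(2)=1$, preserves the Lebesgue measure of an arbitrary interval (segment): for every interval $I\subset[0,1]$, the Lebesgue measure of $f(I)$ equals the Lebesgue measure of $I$.
   Context: $\Delta^3_{\alpha_1\alpha_2\ldots}=\sum_{n\ge1}\alpha_n3^{-n}$ with $\alpha_n\in\{0,1,2\}$ is the ternary representation of a number in $[0,1]$. To make $f:[0,1]\to[0,1]$ well defined, ternary representations with period $(2)$ (i.e. ending in $222\ldots$) are not used, except for the representation $\Delta^3_{(2)}$ of the number $1$. *)

theory Defs
  imports "HOL-Analysis.Analysis"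
begin

text \<open>
  Digit sequences are indexed from 0, so \<open>\<alpha> n\<close> is the \<open>(n + 1)\<close>-st ternary digit,
  of weight \<open>1 / 3 ^ Suc n\<close>.
\<close>

definition ternary_value :: "(nat \<Rightarrow> nat) \<Rightarrow> real" where
  "ternary_value \<alpha> = (\<Sum>n. real (\<alpha> n) / 3 ^ Suc n)"

text \<open>
  Sequences ending in \<open>222\<dots>\<close> are excluded, except for the constant sequence \<open>2\<close>,
  which represents the number 1.
\<close>

definition admissible :: "(nat \<Rightarrow> nat) \<Rightarrow> bool" where
  "admissible \<alpha> \<longleftrightarrow>
     (\<forall>n. \<alpha> n \<in> {0, 1, 2}) \<and>
     ((\<exists>N. \<forall>n\<ge>N. \<alpha> n = 2) \<longrightarrow> (\<forall>n. \<alpha> n = 2))"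

definition ternary_digits :: "real \<Rightarrow> nat \<Rightarrow> nat" where
  "ternary_digits x = (THE \<alpha>. admissible \<alpha> \<and> ternary_value \<alpha> = x)"

text \<open>The value at arguments other than 0, 1, 2 is irrelevant.\<close>

definition theta :: "nat \<Rightarrow> nat" where
  "theta a = (if a = 1 then 2 else if a = 2 then 1 else 0)"

text \<open>Only the values on \<open>{0..1}\<close> are meaningful.\<close>

definition f :: "real \<Rightarrow> real" where
  "f x = ternary_value (\<lambda>n. theta (ternary_digits x n))"

subsection \<open>Existence and uniqueness of the admissible representation\<close>

lemma ternary_two_sums: "(\<lambda>n. 2 / 3 ^ Suc (n + m)) sums (1 / 3 ^ m :: real)"
proof -
  have "(\<lambda>n. (2 / 3 ^ Suc m) * (1 / 3) ^ n) sums ((2 / 3 ^ Suc m) * (1 / (1 - 1 / 3)) :: real)"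
    by (intro sums_mult geometric_sums) simp
  moreover have "(\<lambda>n. (2 / 3 ^ Suc m) * (1 / 3) ^ n) = (\<lambda>n. 2 / 3 ^ Suc (n + m) :: real)"
    by (simp add: power_add power_one_over fun_eq_iff)
  moreover have "(2 / 3 ^ Suc m) * (1 / (1 - 1 / 3)) = (1 / 3 ^ m :: real)"
    by simp
  ultimately show ?thesis
    by simp
qed

lemma ternary_summable:
  assumes "\<forall>n. \<alpha> n \<in> {0, 1, 2 :: nat}"
  shows "summable (\<lambda>n. real (\<alpha> (n + m)) / 3 ^ Suc (n + m))"
proof (rule summable_comparison_test)
  show "summable (\<lambda>n. 2 / 3 ^ Suc (n + m) :: real)"
    using ternary_two_sums by (rule sums_summable)
  have "real (\<alpha> k) \<le> 2" for k
    using assms[rule_format, of k] by auto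
  then show "\<exists>N. \<forall>n\<ge>N. norm (real (\<alpha> (n + m)) / 3 ^ Suc (n + m)) \<le> 2 / 3 ^ Suc (n + m)"
    by (intro exI[of _ 0]) (auto intro!: divide_right_mono)
qed

lemma ternary_tail_nonneg:
  assumes "\<forall>n. \<alpha> n \<in> {0, 1, 2 :: nat}"
  shows "0 \<le> (\<Sum>n. real (\<alpha> (n + m)) / 3 ^ Suc (n + m))"
  by (rule suminf_nonneg[OF ternary_summable[OF assms]]) simp

lemma ternary_tail_less:
  assumes "\<forall>n. \<alpha> n \<in> {0, 1, 2 :: nat}" and "\<exists>n\<ge>m. \<alpha> n \<noteq> 2"
  shows "(\<Sum>n. real (\<alpha> (n + m)) / 3 ^ Suc (n + m)) < 1 / 3 ^ m"
proof -
  let ?t = "\<lambda>n. 2 / 3 ^ Suc (n + m) :: real"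
  let ?a = "\<lambda>n. real (\<alpha> (n + m)) / 3 ^ Suc (n + m)"
  have le: "real (\<alpha> k) \<le> 2" for k
    using assms(1)[rule_format, of k] by auto
  obtain k where k: "m \<le> k" "\<alpha> k \<noteq> 2"
    using assms(2) by blast
  define i where "i = k - m"
  have "\<alpha> (i + m) \<noteq> 2"
    using k by (simp add: i_def)
  then have "real (\<alpha> (i + m)) < 2"
    using assms(1)[rule_format, of "i + m"] by auto
  then have pos: "0 < ?t i - ?a i"
    unfolding diff_gt_0_iff_gt by (intro divide_strict_right_mono) auto
  have st: "summable ?t" and sa: "summable ?a"
    using ternary_two_sums sums_summable ternary_summable[OF assms(1)] by blast+
  have "0 < (\<Sum>n. ?t n - ?a n)"
  proof (rule suminf_pos2[OF summable_diff[OF st sa] _ pos])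
    show "0 \<le> ?t n - ?a n" for n
      unfolding diff_ge_0_iff_ge using le[of "n + m"] by (intro divide_right_mono) auto
  qed
  then show ?thesis
    using suminf_diff[OF st sa] ternary_two_sums[of m] by (simp add: sums_iff)
qed

lemma ternary_value_split:
  assumes "\<forall>n. \<alpha> n \<in> {0, 1, 2 :: nat}"
  shows "ternary_value \<alpha> = (\<Sum>n. real (\<alpha> (n + m)) / 3 ^ Suc (n + m))
           + (\<Sum>n<m. real (\<alpha> n) / 3 ^ Suc n)"
  unfolding ternary_value_def
  using suminf_split_initial_segment[OF ternary_summable[OF assms, of 0], of m] by simp

lemma admissible_not_less:
  assumes "admissible \<alpha>" "admissible \<beta>" "ternary_value \<alpha> = ternary_value \<beta>"
    and "\<And>n. n < m \<Longrightarrow> \<alpha> n = \<beta> n"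
  shows "\<not> \<alpha> m < \<beta> m"
proof
  assume less: "\<alpha> m < \<beta> m"
  have a: "\<forall>n. \<alpha> n \<in> {0, 1, 2}" and b: "\<forall>n. \<beta> n \<in> {0, 1, 2}"
    using assms unfolding admissible_def by auto
  have "\<alpha> m \<noteq> 2"
    using less b[rule_format, of m] by auto
  then have "\<exists>n\<ge>Suc m. \<alpha> n \<noteq> 2"
    using assms(1) unfolding admissible_def by blast
  then have ta: "(\<Sum>n. real (\<alpha> (n + Suc m)) / 3 ^ Suc (n + Suc m)) < 1 / 3 ^ Suc m"
    by (rule ternary_tail_less[OF a])
  have tb: "0 \<le> (\<Sum>n. real (\<beta> (n + Suc m)) / 3 ^ Suc (n + Suc m))"
    by (rule ternary_tail_nonneg[OF b])
  have eq: "(\<Sum>n<m. real (\<alpha> n) / 3 ^ Suc n) = (\<Sum>n<m. real (\<beta> n) / 3 ^ Suc n)"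
    using assms(4) by (intro sum.cong) auto
  have "(real (\<alpha> m) + 1) / 3 ^ Suc m \<le> real (\<beta> m) / 3 ^ Suc m"
    using less by (intro divide_right_mono) auto
  then have d: "real (\<alpha> m) / 3 ^ Suc m + 1 / 3 ^ Suc m \<le> real (\<beta> m) / 3 ^ Suc m"
    by (simp only: add_divide_distrib)
  show False
    using ternary_value_split[OF a, of "Suc m"] ternary_value_split[OF b, of "Suc m"]
      ta tb eq d assms(3) unfolding sum.lessThan_Suc by linarith
qed

lemma admissible_unique:
  assumes "admissible \<alpha>" "admissible \<beta>" "ternary_value \<alpha> = ternary_value \<beta>"
  shows "\<alpha> = \<beta>"
proof
  fix n
  show "\<alpha> n = \<beta> n"
  proof (induction n rule: less_induct)
    case (less m)
    then show ?case
      using admissible_not_less[of \<alpha> \<beta> m] admissible_not_less[of \<beta> \<alpha> m] assms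
      by (metis linorder_neqE_nat)
  qed
qed

lemma admissible_exists:
  assumes "0 \<le> x" "x \<le> 1"
  shows "\<exists>\<alpha>. admissible \<alpha> \<and> ternary_value \<alpha> = x"
proof (cases "x = 1")
  case True
  have "ternary_value (\<lambda>_. 2) = 1"
    using ternary_two_sums[of 0] by (simp add: ternary_value_def sums_iff)
  then show ?thesis
    using True by (intro exI[of _ "\<lambda>_. 2"]) (simp add: admissible_def)
next
  case False
  define F where "F n = \<lfloor>3 ^ n * x\<rfloor>" for n
  define \<alpha> where "\<alpha> n = nat (F (Suc n) mod 3)" for n
  have "F (Suc n) mod 3 \<in> {0, 1, 2}" for n
    using pos_mod_sign[of 3 "F (Suc n)"] pos_mod_bound[of 3 "F (Suc n)"] by auto
  then have digs: "\<forall>n. \<alpha> n \<in> {0, 1, 2}"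
    unfolding \<alpha>_def by fastforce
  have F_div: "F (Suc n) div 3 = F n" for n
    using floor_divide_real_eq_div[of 3 "3 ^ Suc n * x"] unfolding F_def by simp
  have F_Suc: "F (Suc n) = 3 * F n + int (\<alpha> n)" for n
    using mult_div_mod_eq[of 3 "F (Suc n)"] F_div[of n] by (simp add: \<alpha>_def)
  have partial: "(\<Sum>k<n. real (\<alpha> k) / 3 ^ Suc k) = F n / 3 ^ n" for n
  proof (induction n)
    case 0
    have "F 0 = 0"
      using assms False unfolding F_def by (simp add: floor_eq_iff)
    then show ?case by simp
  next
    case (Suc n)
    then show ?case
      using F_Suc[of n] by (simp add: field_simps)
  qed
  have Fb: "F n / 3 ^ n \<le> x" "x < F n / 3 ^ n + 1 / 3 ^ n" for n
  proof -
    have "real_of_int (F n) \<le> 3 ^ n * x" "3 ^ n * x < F n + 1"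
      unfolding F_def by linarith+
    then show "F n / 3 ^ n \<le> x" "x < F n / 3 ^ n + 1 / 3 ^ n"
      by (simp_all add: field_simps)
  qed
  have "(\<lambda>n. (1 / 3) ^ n :: real) \<longlonglongrightarrow> 0"
    by (rule LIMSEQ_realpow_zero) auto
  then have "(\<lambda>n. F n / 3 ^ n) \<longlonglongrightarrow> x"
  proof (rule Lim_transform_bound[rotated, THEN LIM_zero_cancel])
    show "\<forall>\<^sub>F n in sequentially. norm (F n / 3 ^ n - x) \<le> norm ((1 / 3) ^ n :: real)"
      using Fb by (intro always_eventually allI)
        (smt (verit) real_norm_def power_one_over zero_less_power)
  qed
  then have "(\<lambda>n. real (\<alpha> n) / 3 ^ Suc n) sums x"
    unfolding sums_def partial .
  then have val: "ternary_value \<alpha> = x"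
    unfolding ternary_value_def by (simp add: sums_iff)
  have "\<not> (\<forall>n\<ge>N. \<alpha> n = 2)" for N
  proof
    assume two: "\<forall>n\<ge>N. \<alpha> n = 2"
    then have "(\<Sum>n. real (\<alpha> (n + N)) / 3 ^ Suc (n + N)) = 1 / 3 ^ N"
      using ternary_two_sums[of N] by (simp add: sums_iff)
    then show False
      using ternary_value_split[OF digs, of N] partial[of N] Fb(2)[of N] val by simp
  qed
  then have "admissible \<alpha>"
    using digs unfolding admissible_def by blast
  then show ?thesis
    using val by blast
qed

lemma ternary_digits:
  assumes "0 \<le> x" "x \<le> 1"
  shows "admissible (ternary_digits x)" "ternary_value (ternary_digits x) = x"
proof -
  have "\<exists>!\<alpha>. admissible \<alpha> \<and> ternary_value \<alpha> = x"
    using admissible_exists[OF assms] admissible_unique by blast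
  from theI'[OF this]
  show "admissible (ternary_digits x)" "ternary_value (ternary_digits x) = x"
    unfolding ternary_digits_def by auto
qed

lemma f_ternary_value:
  assumes "admissible \<alpha>"
  shows "f (ternary_value \<alpha>) = ternary_value (\<lambda>n. theta (\<alpha> n))"
proof -
  have "ternary_digits (ternary_value \<alpha>) = \<alpha>"
    unfolding ternary_digits_def using assms admissible_unique by blast
  then show ?thesis
    unfolding f_def by simp
qed

end

theory Submission
  imports Defs
begin

text \<open>
  Truncating after \<open>n\<close> digits sends each point of \<open>{0..1}\<close> to one of the closed triadic cells
  \<open>{k / 3 ^ n..(k + 1) / 3 ^ n}\<close>, and \<open>f\<close> acts on the first \<open>n\<close> digits without looking at later
  ones. Hence \<open>f\<close> carries all points whose digits lead to one cell into a single cell of the same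
  size (\<open>prefix_theta\<close>). A segment of length \<open>l\<close> meets at most \<open>l * 3 ^ n + 2\<close> cells of rank \<open>n\<close>, so
  its image is covered by that many cells, of total length at most \<open>l + 2 / 3 ^ n\<close>. Thus \<open>f\<close> does
  not increase the outer measure of a segment (\<open>image_f_cover\<close>).

  The matching lower bound comes from the complement. Because \<open>theta\<close> is an involution, \<open>f\<close>
  reaches every number whose transformed digits are again admissible, in particular every
  irrational number of \<open>{0..1}\<close> (\<open>irrational_in_image_f\<close>). If \<open>I\<close> has end points \<open>a\<close> and \<open>b\<close>, the
  points of \<open>{0..1}\<close> outside \<open>I\<close> lie in \<open>{0..a}\<close> and \<open>{b..1}\<close>; their images have coverings of
  total length close to \<open>a + (1 - b)\<close>, and every irrational number outside these coverings must be
  the image of a point of \<open>I\<close>. So \<open>f ` I\<close> is squeezed between measurable sets of measures close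
  to \<open>b - a\<close>, which gives its measurability and its measure at once.
\<close>

section \<open>Triadic cells\<close>

abbreviation ternary :: "(nat \<Rightarrow> nat) \<Rightarrow> bool" where
  "ternary \<alpha> \<equiv> \<forall>n. \<alpha> n \<in> {0, 1, 2}"

primrec digit_prefix :: "(nat \<Rightarrow> nat) \<Rightarrow> nat \<Rightarrow> nat" where
  "digit_prefix \<alpha> 0 = 0"
| "digit_prefix \<alpha> (Suc n) = 3 * digit_prefix \<alpha> n + \<alpha> n"

lemma sum_digits_eq_prefix:
  "(\<Sum>k<n. real (\<alpha> k) / 3 ^ Suc k) = digit_prefix \<alpha> n / 3 ^ n"
  by (induction n) (simp_all add: field_simps)

lemma ternary_tail_le:
  assumes "ternary \<alpha>"
  shows "(\<Sum>n. real (\<alpha> (n + m)) / 3 ^ Suc (n + m)) \<le> 1 / 3 ^ m"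
proof -
  have le: "real (\<alpha> k) \<le> 2" for k
    using assms[rule_format, of k] by auto
  have "(\<Sum>n. real (\<alpha> (n + m)) / 3 ^ Suc (n + m)) \<le> (\<Sum>n. 2 / 3 ^ Suc (n + m))"
    by (rule suminf_le)
      (use le ternary_summable[OF assms] ternary_two_sums[THEN sums_summable] in
        \<open>auto intro!: divide_right_mono\<close>)
  then show ?thesis
    using ternary_two_sums[of m] by (simp add: sums_iff)
qed

text \<open>
  Both cell end points have to be allowed, because \<open>theta\<close> can turn an admissible sequence into
  one ending in \<open>222\<dots>\<close>.
\<close>

lemma ternary_value_in_cell:
  assumes "ternary \<alpha>"
  shows "ternary_value \<alpha> \<in> {digit_prefix \<alpha> n / 3 ^ n..(real (digit_prefix \<alpha> n) + 1) / 3 ^ n}"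
  using ternary_value_split[OF assms, of n] ternary_tail_nonneg[OF assms, of n]
    ternary_tail_le[OF assms, of n]
  unfolding sum_digits_eq_prefix add_divide_distrib atLeastAtMost_iff by linarith

primrec theta_cell :: "nat \<Rightarrow> nat \<Rightarrow> nat" where
  "theta_cell 0 k = 0"
| "theta_cell (Suc n) k = 3 * theta_cell n (k div 3) + theta (k mod 3)"

lemma prefix_theta:
  assumes "ternary \<alpha>"
  shows "digit_prefix (\<lambda>n. theta (\<alpha> n)) n = theta_cell n (digit_prefix \<alpha> n)"
proof (induction n)
  case (Suc n)
  have "\<alpha> n < 3"
    using assms[rule_format, of n] by auto
  then show ?case
    using Suc by simp
qed simp

lemma ternary_theta: "ternary (\<lambda>n. theta (\<alpha> n))"
  by (simp add: theta_def)

lemma theta_theta: "a \<in> {0, 1, 2} \<Longrightarrow> theta (theta a) = a"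
  by (auto simp: theta_def)

section \<open>Outer measure of the image of a segment\<close>

text \<open>
  The closed cells of rank \<open>n\<close> meeting \<open>{a..b}\<close> have index between \<open>3 ^ n * a - 1\<close> and
  \<open>3 ^ n * b\<close>, so there are at most \<open>3 ^ n * (b - a) + 2\<close> of them, and the surplus \<open>2 / 3 ^ n\<close>
  is absorbed by \<open>e\<close>. The bound concerns subsets of segments because it is applied both to an
  interval and to the two parts of its complement.
\<close>

lemma image_f_cover:
  fixes a b e :: real
  assumes "A \<subseteq> {a..b}" "A \<subseteq> {0..1}" "0 \<le> a" "a \<le> b" "0 < e"
  obtains U where "U \<in> lmeasurable" "f ` A \<subseteq> U" "measure lebesgue U \<le> b - a + e"
proof -
  obtain n where n: "(1 / 3) ^ n < e / 2"
    using real_arch_pow_inv[of "e / 2" "1 / 3"] assms by auto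
  define K where "K = {nat \<lceil>3 ^ n * a - 1\<rceil>..nat \<lfloor>3 ^ n * b\<rfloor>}"
  define C where "C k = {real (theta_cell n k) / 3 ^ n..(real (theta_cell n k) + 1) / 3 ^ n}" for k
  have finK: "finite K"
    unfolding K_def by simp
  have C_meas: "C k \<in> lmeasurable" for k
    unfolding C_def by simp
  have "measure lebesgue (C k) = 1 / 3 ^ n" for k
    unfolding C_def by (simp add: divide_right_mono add_divide_distrib)
  then have le_card: "measure lebesgue (\<Union>k\<in>K. C k) \<le> card K / 3 ^ n"
    using measure_UNION_le[OF finK, of C lebesgue] C_meas by (auto simp: fmeasurableD)
  have ab: "3 ^ n * a \<le> 3 ^ n * b"
    using assms by simp
  have "0 \<le> 3 ^ n * b"
    using assms by simp
  then have "real (nat \<lfloor>3 ^ n * b\<rfloor>) \<le> 3 ^ n * b"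
    by linarith
  moreover have "3 ^ n * a - 1 \<le> real (nat \<lceil>3 ^ n * a - 1\<rceil>)"
    by linarith
  ultimately have "real (card K) \<le> 3 ^ n * (b - a) + 2"
    using ab unfolding K_def card_atLeastAtMost right_diff_distrib by linarith
  then have "card K / 3 ^ n \<le> (3 ^ n * (b - a) + 2) / 3 ^ n"
    by (rule divide_right_mono) simp
  also have "\<dots> = b - a + 2 * (1 / 3) ^ n"
    by (simp add: add_divide_distrib power_one_over)
  finally have "measure lebesgue (\<Union>k\<in>K. C k) \<le> b - a + e"
    using le_card n by linarith
  moreover have "(\<Union>k\<in>K. C k) \<in> lmeasurable"
    using finK C_meas by (intro fmeasurable.finite_UN) auto
  moreover have "f ` A \<subseteq> (\<Union>k\<in>K. C k)"
  proof (rule image_subsetI)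
    fix x assume x: "x \<in> A"
    define \<alpha> where "\<alpha> = ternary_digits x"
    have x01: "0 \<le> x" "x \<le> 1"
      using x assms by auto
    have \<alpha>: "ternary \<alpha>" and val: "ternary_value \<alpha> = x"
      using ternary_digits[OF x01] unfolding \<alpha>_def admissible_def by blast+
    define k where "k = digit_prefix \<alpha> n"
    have "real k / 3 ^ n \<le> x" "x \<le> (real k + 1) / 3 ^ n"
      using ternary_value_in_cell[OF \<alpha>, of n] unfolding val k_def atLeastAtMost_iff by blast+
    then have "real k \<le> 3 ^ n * x" "3 ^ n * x \<le> real k + 1"
      by (simp_all add: field_simps)
    moreover have "3 ^ n * a \<le> 3 ^ n * x" "3 ^ n * x \<le> 3 ^ n * b"
      using x assms by auto
    ultimately have "3 ^ n * a - 1 \<le> real k" "real k \<le> 3 ^ n * b"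
      by linarith+
    then have "k \<in> K"
      unfolding K_def by (simp add: le_nat_iff nat_le_iff le_floor_iff ceiling_le_iff) linarith
    moreover have "f x \<in> C k"
      using ternary_value_in_cell[OF ternary_theta[of \<alpha>], of n] prefix_theta[OF \<alpha>, of n]
      unfolding f_def C_def k_def \<alpha>_def by simp
    ultimately show "f x \<in> (\<Union>k\<in>K. C k)"
      by blast
  qed
  ultimately show ?thesis
    using that by blast
qed

section \<open>Almost surjectivity\<close>

text \<open>
  The digits \<open>\<alpha>\<close> of \<open>y\<close> come from a preimage as soon as \<open>theta \<circ> \<alpha>\<close> is admissible. That can
  fail only if \<open>\<alpha>\<close> ends in \<open>111\<dots>\<close>, and then \<open>y\<close> is a triadic fraction plus
  \<open>1 / (2 * 3 ^ N)\<close>.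
\<close>

lemma irrational_in_image_f:
  assumes "y \<in> {0..1} - \<rat>"
  shows "y \<in> f ` {0..1}"
proof -
  define \<alpha> where "\<alpha> = ternary_digits y"
  define \<beta> where "\<beta> n = theta (\<alpha> n)" for n
  have \<alpha>: "ternary \<alpha>" and val: "ternary_value \<alpha> = y"
    using ternary_digits[of y] assms unfolding \<alpha>_def admissible_def by auto
  have \<beta>: "ternary \<beta>"
    using ternary_theta unfolding \<beta>_def .
  have "\<not> (\<forall>n\<ge>N. \<beta> n = 2)" for N
  proof
    assume "\<forall>n\<ge>N. \<beta> n = 2"
    then have one: "\<alpha> n = 1" if "n \<ge> N" for n
      using that by (auto simp: \<beta>_def theta_def split: if_splits)
    have "(\<lambda>n. real (\<alpha> (n + N)) / 3 ^ Suc (n + N)) sums (1 / 3 ^ N / 2)"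
      using sums_divide[OF ternary_two_sums[of N], of 2] by (simp add: one)
    then have "y = 1 / 3 ^ N / 2 + digit_prefix \<alpha> N / 3 ^ N"
      using ternary_value_split[OF \<alpha>, of N] val
      by (simp only: sum_digits_eq_prefix sums_iff)
    also have "\<dots> \<in> \<rat>"
      by (intro Rats_add Rats_divide Rats_power) auto
    finally show False
      using assms by simp
  qed
  then have "admissible \<beta>"
    using \<beta> unfolding admissible_def by blast
  then have "f (ternary_value \<beta>) = ternary_value (\<lambda>n. theta (\<beta> n))"
    by (rule f_ternary_value)
  also have "(\<lambda>n. theta (\<beta> n)) = \<alpha>"
    using theta_theta \<alpha> unfolding \<beta>_def by blast
  finally have "f (ternary_value \<beta>) = y"
    using val by simp
  moreover have "ternary_value \<beta> \<in> {0..1}"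
    using ternary_value_in_cell[OF \<beta>, of 0] by simp
  ultimately show ?thesis
    by blast
qed

section \<open>Measure of the image of an interval\<close>

text \<open>
  For the lower bound, a point of \<open>{0..1} - \<rat>\<close> avoiding coverings of the images of the two parts
  of \<open>{0..1} - I\<close> can only be an image of a point of \<open>I\<close>.
\<close>

lemma measure_image_f_segment:
  fixes a b :: real
  assumes "0 \<le> a" "a \<le> b" "b \<le> 1" "{a<..<b} \<subseteq> I" "I \<subseteq> {a..b}"
  shows "f ` I \<in> lmeasurable \<and> b - a = measure lebesgue (f ` I)"
  unfolding completion.fmeasurable_measure_inner_outer_le
proof (intro conjI allI impI)
  fix e :: real
  assume e: "0 < e"
  have I01: "I \<subseteq> {0..1}"
    using assms by auto
  obtain U where "U \<in> lmeasurable" "f ` I \<subseteq> U" "measure lebesgue U \<le> b - a + e"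
    by (rule image_f_cover[OF assms(5) I01 assms(1,2) e])
  then show "\<exists>U\<in>lmeasurable. f ` I \<subseteq> U \<and> measure lebesgue U \<le> b - a + e"
    by blast
next
  fix e :: real
  assume "0 < e"
  then have e: "0 < e / 2"
    by simp
  obtain V where V: "V \<in> lmeasurable" "f ` ({0..a} - I) \<subseteq> V" "measure lebesgue V \<le> a - 0 + e / 2"
    by (rule image_f_cover[of "{0..a} - I" 0 a "e / 2"]) (use assms e in auto)
  obtain W where W: "W \<in> lmeasurable" "f ` ({b..1} - I) \<subseteq> W" "measure lebesgue W \<le> 1 - b + e / 2"
    by (rule image_f_cover[of "{b..1} - I" b 1 "e / 2"]) (use assms e in auto)
  define S where "S = {0..1 :: real} - \<rat>"
  have null: "(\<rat> :: real set) \<in> null_sets lebesgue"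
    using countable_rat countable_imp_null_set_lborel by (blast intro: null_sets_completionI)
  have S: "S \<in> lmeasurable" "measure lebesgue S = 1"
    unfolding S_def using null by (auto simp: measure_Diff_null_set intro: fmeasurable_Diff)
  have VW: "V \<union> W \<in> lmeasurable"
    using V W by auto
  have "measure lebesgue (V \<union> W) \<le> measure lebesgue V + measure lebesgue W"
    using V W by (intro measure_Un_le) auto
  then have "b - a - e \<le> measure lebesgue S - measure lebesgue (V \<union> W)"
    using V W S by linarith
  also have "\<dots> \<le> measure lebesgue (S - (V \<union> W))"
    using S VW by (intro measure_diff_le_measure_setdiff)
  finally have "b - a - e \<le> measure lebesgue (S - (V \<union> W))" .
  moreover have "S - (V \<union> W) \<subseteq> f ` I"
  proof
    fix y assume y: "y \<in> S - (V \<union> W)"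
    then obtain x where x: "x \<in> {0..1}" "y = f x"
      using irrational_in_image_f[of y] unfolding S_def by blast
    have "x \<in> I"
    proof (rule ccontr)
      assume "x \<notin> I"
      then have "x \<notin> {a<..<b}"
        using assms(4) by blast
      with \<open>x \<notin> I\<close> have "x \<in> {0..a} - I \<or> x \<in> {b..1} - I"
        using x by auto
      then show False
        using V W y x by blast
    qed
    then show "y \<in> f ` I"
      using x by blast
  qed
  moreover have "S - (V \<union> W) \<in> lmeasurable"
    using S VW by (intro fmeasurable.Diff)
  ultimately show "\<exists>T\<in>lmeasurable. T \<subseteq> f ` I \<and> b - a - e \<le> measure lebesgue T"
    by blast
qed

lemma bounded_interval_between:
  fixes I :: "real set"
  assumes "is_interval I" "I \<noteq> {}" "bdd_below I" "bdd_above I"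
  shows "{Inf I<..<Sup I} \<subseteq> I" "I \<subseteq> {Inf I..Sup I}"
proof
  fix x assume "x \<in> {Inf I<..<Sup I}"
  then obtain u v where "u \<in> I" "u < x" "v \<in> I" "x < v"
    using assms by (auto simp: cInf_less_iff less_cSup_iff)
  then show "x \<in> I"
    using assms(1) unfolding is_interval_1 by (meson less_imp_le)
next
  show "I \<subseteq> {Inf I..Sup I}"
    using assms by (auto intro: cInf_lower cSup_upper)
qed

lemma measure_between_segments:
  fixes a b :: real
  assumes "a \<le> b" "{a<..<b} \<subseteq> I" "I \<subseteq> {a..b}"
  shows "I \<in> lmeasurable" "measure lebesgue I = b - a"
proof -
  have "I \<in> lmeasurable \<and> b - a = measure lebesgue I"
    unfolding completion.fmeasurable_measure_inner_outer_le
    using assms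
    by (intro conjI allI impI bexI[of _ "{a<..<b}"] bexI[of _ "{a..b}"]) auto
  then show "I \<in> lmeasurable" "measure lebesgue I = b - a"
    by auto
qed

theorem theorem3:
  fixes I :: "real set"
  assumes "is_interval I" and "I \<subseteq> {0..1}"
  shows "f ` I \<in> sets lebesgue \<and> emeasure lebesgue (f ` I) = emeasure lebesgue I"
proof (cases "I = {}")
  case False
  define a b where "a = Inf I" and "b = Sup I"
  have bdd: "bdd_below I" "bdd_above I"
    using assms(2) by (auto intro: bdd_below_mono bdd_above_mono)
  have between: "{a<..<b} \<subseteq> I" "I \<subseteq> {a..b}"
    using bounded_interval_between[OF assms(1) False bdd] unfolding a_def b_def by auto
  have "0 \<le> a" "b \<le> 1"
    unfolding a_def b_def using False assms(2) by (auto intro!: cInf_greatest cSup_least)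
  moreover have "a \<le> b"
    using False between(2) by force
  ultimately have "f ` I \<in> lmeasurable" "measure lebesgue (f ` I) = measure lebesgue I"
      "I \<in> lmeasurable"
    using measure_image_f_segment[of a b I] measure_between_segments[of a b I] between by auto
  then show ?thesis
    by (simp add: emeasure_eq_measure2 fmeasurableD)
qed simp

end
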